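(* If $E_1$ and $E_2$ are $\leq$-incomparable ceers and at least one of them is dark, then $E_1$ and $E_2$ have no greatest lower bound in the poset of degrees of ceers.
   Context: A ceer is a computably enumerable equivalence relation on $\omega$. For equivalence relations $E,R$ on $\omega$, $E\leq R$ means there is a computable $f$ with $x\mathrel{E}y\iff f(x)\mathrel{R}f(y)$ for all $x,y$; the degrees of ceers are the mutual-reducibility classes, ordered by $\leq$. $\mathrm{Id}$ is equality on $\omega$. A ceer $R$ is dark if it has infinitely many classes and $\mathrm{Id}\not\leq R$. *)

theory Defs
  imports "HOL-Algebra.Lattice"
begin

section \<open>Partial recursive functions\<close>

text \<open>
  Programs for Kleene's partial recursive functions, acting on argument lists of arbitrary length.
  \<open>rec_eval p xs y\<close> says that \<open>p\<close> halts on the arguments \<open>xs\<close> with output \<open>y\<close>. Primitive recursion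
  and minimisation act on the first argument. Programs carry no arity:
  superfluous arguments are ignored, and accessing a missing one diverges.
\<close>

datatype recprog =
    Zero
  | Succ
  | Proj nat
  | Comp recprog "recprog list"
  | PrimRec recprog recprog
  | Mu recprog

inductive rec_eval :: "recprog \<Rightarrow> nat list \<Rightarrow> nat \<Rightarrow> bool" where
  zero: "rec_eval Zero xs 0"
| succ: "rec_eval Succ (x # xs) (Suc x)"
| proj: "i < length xs \<Longrightarrow> rec_eval (Proj i) xs (xs ! i)"
| comp: "list_all2 (\<lambda>g y. rec_eval g xs y) gs ys \<Longrightarrow> rec_eval f ys z
    \<Longrightarrow> rec_eval (Comp f gs) xs z"
| prim_0: "rec_eval f xs y \<Longrightarrow> rec_eval (PrimRec f g) (0 # xs) y"
| prim_Suc: "rec_eval (PrimRec f g) (n # xs) y \<Longrightarrow> rec_eval g (n # y # xs) z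
    \<Longrightarrow> rec_eval (PrimRec f g) (Suc n # xs) z"
| mu: "rec_eval f (n # xs) 0 \<Longrightarrow> (\<forall>i<n. \<exists>y>0. rec_eval f (i # xs) y)
    \<Longrightarrow> rec_eval (Mu f) xs n"
  monos list_all2_mono

inductive_cases rec_eval_ZeroE: "rec_eval Zero xs y"
inductive_cases rec_eval_SuccE: "rec_eval Succ xs y"
inductive_cases rec_eval_ProjE: "rec_eval (Proj i) xs y"
inductive_cases rec_eval_CompE: "rec_eval (Comp f gs) xs y"
inductive_cases rec_eval_PrimRec_0E: "rec_eval (PrimRec f g) (0 # xs) y"
inductive_cases rec_eval_PrimRec_SucE: "rec_eval (PrimRec f g) (Suc n # xs) y"
inductive_cases rec_eval_MuE: "rec_eval (Mu f) xs y"

lemma rec_eval_unique: "rec_eval p xs y \<Longrightarrow> rec_eval p xs y' \<Longrightarrow> y = y'"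
proof (induction arbitrary: y' rule: rec_eval.induct)
  case (zero xs)
  then show ?case by (rule rec_eval_ZeroE) simp
next
  case (succ x xs)
  then show ?case by (rule rec_eval_SuccE) simp
next
  case (proj i xs)
  from proj(2) show ?case by (rule rec_eval_ProjE) simp
next
  case (comp xs gs ys f z)
  obtain ys' where ys': "list_all2 (\<lambda>g y. rec_eval g xs y) gs ys'" "rec_eval f ys' y'"
    using comp.prems by (rule rec_eval_CompE) blast
  have "ys = ys'"
    using comp.IH(1) ys'(1) by (simp add: list_all2_conv_all_nth list_eq_iff_nth_eq)
  with ys' comp.IH(2) show ?case by blast
next
  case (prim_0 f xs y g)
  from prim_0.prems have "rec_eval f xs y'" by (rule rec_eval_PrimRec_0E)
  with prim_0.IH show ?case by blast
next
  case (prim_Suc f g n xs y z)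
  obtain w where "rec_eval (PrimRec f g) (n # xs) w" "rec_eval g (n # w # xs) y'"
    using prim_Suc.prems by (rule rec_eval_PrimRec_SucE) blast
  with prim_Suc.IH show ?case by blast
next
  case (mu f n xs)
  from mu.prems have y': "rec_eval f (y' # xs) 0 \<and> (\<forall>i<y'. \<exists>y>0. rec_eval f (i # xs) y)"
    by (rule rec_eval_MuE) blast
  show ?case
  proof (rule linorder_cases[of n y'])
    assume "n < y'"
    with y' obtain y where "y > 0" "rec_eval f (n # xs) y" by blast
    with mu.IH(1) show ?thesis by fastforce
  next
    assume "y' < n"
    with mu.IH(2) y' show ?thesis by fastforce
  qed
qed

definition computable :: "(nat \<Rightarrow> nat) \<Rightarrow> bool" where
  "computable f \<longleftrightarrow> (\<exists>p. \<forall>x y. rec_eval p [x] y \<longleftrightarrow> y = f x)"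

text \<open>A binary relation is c.e. if it is the domain of a binary partial recursive function.\<close>

definition ce_rel :: "nat rel \<Rightarrow> bool" where
  "ce_rel R \<longleftrightarrow> (\<exists>p. \<forall>x y. (x, y) \<in> R \<longleftrightarrow> (\<exists>z. rec_eval p [x, y] z))"

lemma computable_id: "computable (\<lambda>x. x)"
  unfolding computable_def
proof (intro exI allI)
  show "rec_eval (Proj 0) [x] y \<longleftrightarrow> y = x" for x y
    by (subst rec_eval.simps) simp
qed

lemma rec_eval_Comp_iff:
  "rec_eval (Comp f gs) xs z \<longleftrightarrow> (\<exists>ys. list_all2 (\<lambda>g y. rec_eval g xs y) gs ys \<and> rec_eval f ys z)"
  by (subst rec_eval.simps) auto

lemma computable_compose:
  assumes "computable f" "computable g"
  shows "computable (\<lambda>x. g (f x))"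
proof -
  from assms obtain p q where
    "\<And>x y. rec_eval p [x] y \<longleftrightarrow> y = f x" "\<And>x y. rec_eval q [x] y \<longleftrightarrow> y = g x"
    unfolding computable_def by blast
  then have "\<forall>x y. rec_eval (Comp q [p]) [x] y \<longleftrightarrow> y = g (f x)"
    by (auto simp: rec_eval_Comp_iff list_all2_Cons1)
  then show ?thesis unfolding computable_def by blast
qed


section \<open>Ceers, computable reducibility and dark ceers\<close>

definition ceer :: "nat rel \<Rightarrow> bool" where
  "ceer R \<longleftrightarrow> equiv UNIV R \<and> ce_rel R"

definition reducible :: "nat rel \<Rightarrow> nat rel \<Rightarrow> bool" (infix \<open>\<le>\<^sub>c\<close> 50) where
  "E \<le>\<^sub>c R \<longleftrightarrow> (\<exists>f. computable f \<and> (\<forall>x y. (x, y) \<in> E \<longleftrightarrow> (f x, f y) \<in> R))"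

definition dark :: "nat rel \<Rightarrow> bool" where
  "dark R \<longleftrightarrow> ceer R \<and> infinite (UNIV // R) \<and> \<not> Id \<le>\<^sub>c R"

lemma reducible_refl: "E \<le>\<^sub>c E"
  unfolding reducible_def using computable_id by blast

lemma reducible_trans:
  assumes "E \<le>\<^sub>c R" "R \<le>\<^sub>c S"
  shows "E \<le>\<^sub>c S"
proof -
  from assms obtain f g where "computable f" "computable g"
    "\<forall>x y. (x, y) \<in> E \<longleftrightarrow> (f x, f y) \<in> R" "\<forall>x y. (x, y) \<in> R \<longleftrightarrow> (g x, g y) \<in> S"
    unfolding reducible_def by blast
  then show ?thesis
    unfolding reducible_def using computable_compose[of f g] by (intro exI[of _ "\<lambda>x. g (f x)"]) simp
qed


section \<open>The poset of degrees of ceers\<close>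

definition ceer_equiv :: "nat rel rel" where
  "ceer_equiv = {(E, R). ceer E \<and> ceer R \<and> E \<le>\<^sub>c R \<and> R \<le>\<^sub>c E}"

definition ceer_degree :: "nat rel \<Rightarrow> nat rel set" where
  "ceer_degree E = ceer_equiv `` {E}"

definition ceer_degrees :: "nat rel set gorder" where
  "ceer_degrees = \<lparr> carrier = Collect ceer // ceer_equiv, eq = (=),
     le = (\<lambda>a b. \<exists>E\<in>a. \<exists>R\<in>b. E \<le>\<^sub>c R) \<rparr>"

lemma equiv_ceer_equiv: "equiv (Collect ceer) ceer_equiv"
  by (rule equivI)
    (auto simp: ceer_equiv_def refl_on_def sym_def trans_def intro: reducible_refl reducible_trans)

lemma carrier_ceer_degrees: "carrier ceer_degrees = ceer_degree ` Collect ceer"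
  by (auto simp: ceer_degrees_def ceer_degree_def quotient_def)

lemma ceer_degree_eq_iff:
  "ceer E \<Longrightarrow> ceer R \<Longrightarrow> ceer_degree E = ceer_degree R \<longleftrightarrow> E \<le>\<^sub>c R \<and> R \<le>\<^sub>c E"
  using eq_equiv_class_iff[OF equiv_ceer_equiv, of E R]
  by (simp add: ceer_degree_def ceer_equiv_def)

lemma ceer_degree_le_iff:
  "ceer E \<Longrightarrow> ceer R \<Longrightarrow> ceer_degree E \<sqsubseteq>\<^bsub>ceer_degrees\<^esub> ceer_degree R \<longleftrightarrow> E \<le>\<^sub>c R"
  by (auto simp: ceer_degrees_def ceer_degree_def ceer_equiv_def
      intro: reducible_refl reducible_trans)

lemma partial_order_ceer_degrees: "partial_order ceer_degrees"
proof -
  have eq: "(.=\<^bsub>ceer_degrees\<^esub>) = (=)"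
    by (simp add: ceer_degrees_def)
  show ?thesis
    by unfold_locales
      (auto simp: eq carrier_ceer_degrees ceer_degree_le_iff
        intro: reducible_refl reducible_trans, (metis ceer_degree_eq_iff)+)
qed

end

theory Submission
  imports Defs
begin

text \<open>
  Let \<open>D\<close> be a lower bound of \<open>E1\<close> and \<open>E2\<close>. If a reduction \<open>f\<close> of \<open>D\<close> to \<open>E1\<close> met every
  \<open>E1\<close>-class, then searching for \<open>y\<close> with \<open>f y\<close> equivalent to a given \<open>x\<close> would reduce \<open>E1\<close> to \<open>D\<close>,
  hence to \<open>E2\<close>. So \<open>f\<close> misses a class of \<open>E1\<close>, and the sum \<open>D \<oplus> Id\<^sub>1\<close>, that is \<open>D\<close> with one more
  class, reduces to \<open>E1\<close>; likewise to \<open>E2\<close>. If \<open>D\<close> were greatest, then \<open>D \<oplus> Id\<^sub>1 \<le>\<^sub>c D\<close>, and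
  iterating this reduction on the class it adds yields pairwise inequivalent numbers, so
  \<open>Id \<le>\<^sub>c D\<close>, which darkness of \<open>E1\<close> or \<open>E2\<close> forbids.
\<close>

section \<open>Total recursive functions\<close>

text \<open>Programs carry no arity, so the length \<open>n\<close> is fixed here. \<open>F\<close>
  is unconstrained on lists of other lengths, which lets \<open>recfn_cong\<close> change it
  there.\<close>

definition recfn :: "nat \<Rightarrow> (nat list \<Rightarrow> nat) \<Rightarrow> bool" where
  "recfn n F \<longleftrightarrow> (\<exists>p. \<forall>xs. length xs = n \<longrightarrow> rec_eval p xs (F xs))"

lemma recfn_cong:
  assumes "recfn n F" "\<And>xs. length xs = n \<Longrightarrow> F xs = G xs"
  shows "recfn n G"
  using assms unfolding recfn_def by metis

lemma recfn_zero: "recfn n (\<lambda>_. 0)"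
  unfolding recfn_def by (blast intro: rec_eval.zero)

lemma recfn_proj: "i < n \<Longrightarrow> recfn n (\<lambda>xs. xs ! i)"
  unfolding recfn_def by (blast intro: rec_eval.proj)

lemma recfn_compose:
  assumes F: "recfn (length Gs) F" and Gs: "\<And>G. G \<in> set Gs \<Longrightarrow> recfn n G"
  shows "recfn n (\<lambda>xs. F (map (\<lambda>G. G xs) Gs))"
proof -
  obtain p where p: "\<And>ys. length ys = length Gs \<Longrightarrow> rec_eval p ys (F ys)"
    using F unfolding recfn_def by blast
  obtain q where q: "\<And>G xs. G \<in> set Gs \<Longrightarrow> length xs = n \<Longrightarrow> rec_eval (q G) xs (G xs)"
    using Gs unfolding recfn_def by metis
  have "rec_eval (Comp p (map q Gs)) xs (F (map (\<lambda>G. G xs) Gs))" if "length xs = n" for xs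
    by (rule rec_eval.comp[of _ _ "map (\<lambda>G. G xs) Gs"])
      (use p q that in \<open>auto simp: list_all2_conv_all_nth\<close>)
  then show ?thesis unfolding recfn_def by blast
qed

lemma recfn_Suc: "recfn n F \<Longrightarrow> recfn n (\<lambda>xs. Suc (F xs))"
proof -
  have "recfn 1 (\<lambda>xs. Suc (hd xs))"
    unfolding recfn_def by (rule exI[of _ Succ]) (auto simp: length_Suc_conv intro: rec_eval.succ)
  then show "recfn n F \<Longrightarrow> recfn n (\<lambda>xs. Suc (F xs))"
    using recfn_compose[of "[F]" "\<lambda>xs. Suc (hd xs)" n] by simp
qed

lemma recfn_const: "recfn n (\<lambda>_. c)"
  by (induction c) (auto intro: recfn_zero recfn_Suc)

lemma recfn_compose1:
  "recfn 1 F \<Longrightarrow> recfn n G \<Longrightarrow> recfn n (\<lambda>xs. F [G xs])"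
  using recfn_compose[of "[G]" F n] by simp

lemma recfn_compose2:
  "recfn 2 F \<Longrightarrow> recfn n G \<Longrightarrow> recfn n H \<Longrightarrow> recfn n (\<lambda>xs. F [G xs, H xs])"
  using recfn_compose[of "[G, H]" F n] by (auto simp: numeral_2_eq_2)

text \<open>Replaces the first \<open>k\<close> arguments and hands on the others, which takes one
  projection for each of the \<open>m\<close> remaining positions.\<close>

lemma recfn_compose_append:
  assumes F: "recfn (length Gs + m) F" and Gs: "\<And>G. G \<in> set Gs \<Longrightarrow> recfn n G" and n: "n = k + m"
  shows "recfn n (\<lambda>xs. F (map (\<lambda>G. G xs) Gs @ drop k xs))"
proof -
  let ?Gs = "Gs @ map (\<lambda>i xs. xs ! (k + i)) [0..<m]"
  have "recfn n (\<lambda>xs. F (map (\<lambda>G. G xs) ?Gs))"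
    by (rule recfn_compose) (use assms in \<open>auto intro: recfn_proj\<close>)
  moreover have "map (\<lambda>G. G xs) ?Gs = map (\<lambda>G. G xs) Gs @ drop k xs" if "length xs = n" for xs
    using that n by (auto simp: o_def intro!: nth_equalityI)
  ultimately show ?thesis using recfn_cong by force
qed

lemma recfn_Cons:
  "recfn (Suc n) F \<Longrightarrow> recfn n G \<Longrightarrow> recfn n (\<lambda>xs. F (G xs # xs))"
  using recfn_compose_append[of "[G]" n F n 0] by simp

lemma recfn_drop:
  "recfn n F \<Longrightarrow> recfn (k + n) (\<lambda>xs. F (drop k xs))"
  using recfn_compose_append[of "[]" n F "k + n" k] by simp

text \<open>\<open>PrimRec\<close> recurses on its first argument, so the count is first a new head
  of the list and then replaced by \<open>N xs\<close>.\<close>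

lemma recfn_rec_nat:
  assumes N: "recfn n N" and A: "recfn n A" and B: "recfn (Suc (Suc n)) B"
  shows "recfn n (\<lambda>xs. rec_nat (A xs) (\<lambda>k v. B (k # v # xs)) (N xs))"
proof -
  obtain p q where p: "\<And>xs. length xs = n \<Longrightarrow> rec_eval p xs (A xs)"
    and q: "\<And>xs. length xs = Suc (Suc n) \<Longrightarrow> rec_eval q xs (B xs)"
    using A B unfolding recfn_def by blast
  have "rec_eval (PrimRec p q) (k # xs) (rec_nat (A xs) (\<lambda>k v. B (k # v # xs)) k)"
    if "length xs = n" for k xs
    by (induction k) (use p q that in \<open>auto intro: rec_eval.prim_0 rec_eval.prim_Suc\<close>)
  then have "recfn (Suc n) (\<lambda>ys. rec_nat (A (tl ys)) (\<lambda>k v. B (k # v # tl ys)) (hd ys))"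
    unfolding recfn_def by (intro exI[of _ "PrimRec p q"]) (auto simp: length_Suc_conv)
  from recfn_Cons[OF this N] show ?thesis by simp
qed

text \<open>Primitive recursion on \<open>C xs\<close> whose step ignores the counter and the
  previous value: \<open>drop 2\<close> discards both.\<close>

lemma recfn_if:
  assumes "recfn n C" "recfn n A" "recfn n B"
  shows "recfn n (\<lambda>xs. if C xs = 0 then A xs else B xs)"
proof -
  have "recfn (Suc (Suc n)) (\<lambda>ys. B (drop 2 ys))"
    using recfn_drop[OF assms(3), of 2] by simp
  from recfn_rec_nat[OF assms(1,2) this] show ?thesis
    by (rule recfn_cong) (auto split: nat.split simp: gr0_conv_Suc)
qed

lemma recfn_pred: "recfn n F \<Longrightarrow> recfn n (\<lambda>xs. F xs - 1)"
proof -
  assume F: "recfn n F"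
  have "recfn n (\<lambda>xs. rec_nat 0 (\<lambda>k v. (k # v # xs) ! 0) (F xs))"
    by (rule recfn_rec_nat) (auto intro: F recfn_zero recfn_proj)
  then show ?thesis
  proof (rule recfn_cong)
    show "rec_nat 0 (\<lambda>k v. (k # v # xs) ! 0) (F xs) = F xs - 1" for xs
      by (cases "F xs") auto
  qed
qed

text \<open>\<open>ex\<close> makes the search halt, and totality of \<open>F\<close> supplies the
  positive values below the least zero that \<open>rec_eval.mu\<close> demands.\<close>

lemma recfn_Least:
  assumes F: "recfn (Suc n) F" and ex: "\<And>xs. length xs = n \<Longrightarrow> \<exists>s. F (s # xs) = 0"
  shows "recfn n (\<lambda>xs. LEAST s. F (s # xs) = 0)"
proof -
  obtain p where p: "\<And>xs. length xs = Suc n \<Longrightarrow> rec_eval p xs (F xs)"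
    using F unfolding recfn_def by blast
  have "rec_eval (Mu p) xs (LEAST s. F (s # xs) = 0)" if len: "length xs = n" for xs
  proof (rule rec_eval.mu)
    show "rec_eval p ((LEAST s. F (s # xs) = 0) # xs) 0"
      using p[of "(LEAST s. F (s # xs) = 0) # xs"] LeastI_ex[OF ex[OF len]] len by simp
    show "\<forall>i<LEAST s. F (s # xs) = 0. \<exists>y>0. rec_eval p (i # xs) y"
    proof (intro allI impI)
      fix i
      assume "i < (LEAST s. F (s # xs) = 0)"
      then have "F (i # xs) > 0" using not_less_Least by blast
      then show "\<exists>y>0. rec_eval p (i # xs) y"
        using p[of "i # xs"] len by auto
    qed
  qed
  then show ?thesis unfolding recfn_def by blast
qed

lemma computable_iff_recfn: "computable f \<longleftrightarrow> recfn 1 (\<lambda>xs. f (hd xs))"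
proof
  assume "computable f"
  then show "recfn 1 (\<lambda>xs. f (hd xs))"
    unfolding computable_def recfn_def by (fastforce simp: length_Suc_conv)
next
  assume "recfn 1 (\<lambda>xs. f (hd xs))"
  then obtain p where "\<forall>xs. length xs = 1 \<longrightarrow> rec_eval p xs (f (hd xs))"
    unfolding recfn_def by blast
  then have "rec_eval p [x] (f x)" for x
    by (metis length_Cons list.sel(1) list.size(3) One_nat_def)
  then show "computable f"
    unfolding computable_def by (intro exI[of _ p]) (auto intro: rec_eval_unique)
qed

section \<open>Evaluation with bounded search\<close>

text \<open>
  The parameter \<open>s\<close> bounds every minimisation. The result \<open>0\<close> means that no value has been found, and
  \<open>Suc y\<close> means that the value is \<open>y\<close>. In the same way the state of the search is \<open>0\<close> while it runs,
  \<open>1\<close> once the searched function has failed, and \<open>k + 2\<close> once \<open>k\<close> has been found.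
\<close>

definition search_step :: "nat \<Rightarrow> nat \<Rightarrow> nat \<Rightarrow> nat" where
  "search_step k v e = (if v = 0 then if e = 0 then 1 else if e - 1 = 0 then Suc (Suc k) else 0 else v)"

fun bounded_eval :: "recprog \<Rightarrow> nat \<Rightarrow> nat list \<Rightarrow> nat" where
  "bounded_eval Zero s xs = 1"
| "bounded_eval Succ s xs = (if xs = [] then 0 else Suc (Suc (hd xs)))"
| "bounded_eval (Proj i) s xs = (if i < length xs then Suc (xs ! i) else 0)"
| "bounded_eval (Comp f gs) s xs =
    (if 0 \<in> set (map (\<lambda>g. bounded_eval g s xs) gs) then 0
     else bounded_eval f s (map (\<lambda>g. bounded_eval g s xs - 1) gs))"
| "bounded_eval (PrimRec f g) s xs =
    (if xs = [] then 0
     else rec_nat (bounded_eval f s (tl xs))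
       (\<lambda>k v. if v = 0 then 0 else bounded_eval g s (k # (v - 1) # tl xs)) (hd xs))"
| "bounded_eval (Mu f) s xs =
    rec_nat 0 (\<lambda>k v. search_step k v (bounded_eval f s (k # xs))) s - 1"

section \<open>Correctness of bounded evaluation\<close>

lemma search_eq_0_iff:
  "rec_nat 0 (\<lambda>k v. search_step k v (e k)) t = 0 \<longleftrightarrow> (\<forall>i<t. e i > 1)"
  by (induction t) (auto simp: search_step_def less_Suc_eq)

text \<open>A nonzero state never changes, so \<open>n\<close> can only be recorded while the state
  is still 0. Here \<open>e i\<close> is 0 for no value, 1 for the value 0, and larger for a
  positive value.\<close>

lemma search_eq_found_iff:
  "rec_nat 0 (\<lambda>k v. search_step k v (e k)) t = Suc (Suc n) \<longleftrightarrow>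
    n < t \<and> e n = 1 \<and> (\<forall>i<n. e i > 1)"
proof (induction t)
  case (Suc t)
  show ?case
  proof (cases "rec_nat 0 (\<lambda>k v. search_step k v (e k)) t = 0")
    case True
    with search_eq_0_iff[of e t] have "\<forall>i<t. e i > 1" by simp
    then show ?thesis using True by (auto simp: search_step_def less_Suc_eq)
  next
    case False
    \<comment> \<open>Some earlier \<open>e i\<close> stopped the search, so \<open>n = t\<close> is
      excluded on the right-hand side as well.\<close>
    then have "\<exists>i<t. e i \<le> 1" using search_eq_0_iff[of e t] by (auto simp: not_less)
    then show ?thesis using False Suc by (auto simp: search_step_def less_Suc_eq not_less)
  qed
qed simp

text \<open>The final \<open>- 1\<close> sends the states 0 and 1 both to 0, and the state
  \<open>k + 2\<close> to \<open>Suc k\<close>.\<close>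

lemma bounded_eval_Mu_iff:
  "bounded_eval (Mu f) s xs = Suc n \<longleftrightarrow>
    n < s \<and> bounded_eval f s (n # xs) = 1 \<and> (\<forall>i<n. bounded_eval f s (i # xs) > 1)"
  using search_eq_found_iff[of "\<lambda>k. bounded_eval f s (k # xs)" s n] by auto

lemma bounded_eval_sound: "bounded_eval p s xs = Suc y \<Longrightarrow> rec_eval p xs y"
proof (induction p arbitrary: xs y)
  case Zero
  then show ?case by (simp add: rec_eval.zero)
next
  case Succ
  then show ?case by (cases xs) (auto intro: rec_eval.succ)
next
  case (Proj i)
  then show ?case by (auto intro: rec_eval.proj split: if_splits)
next
  case (Comp f gs)
  \<comment> \<open>The guard of the \<open>Comp\<close> clause excludes 0, so subtracting 1
    recovers the actual values.\<close>
  have "rec_eval g xs (bounded_eval g s xs - 1)" if "g \<in> set gs" for g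
    using that Comp.IH(2)[of g xs "bounded_eval g s xs - 1"] Comp.prems
    by (force split: if_splits)
  moreover have "rec_eval f (map (\<lambda>g. bounded_eval g s xs - 1) gs) y"
    using Comp.prems by (intro Comp.IH(1)) (auto split: if_splits)
  ultimately show ?case
    by (intro rec_eval.comp) (auto simp: list_all2_conv_all_nth)
next
  case (PrimRec f g)
  then obtain n zs where xs: "xs = n # zs" by (cases xs) auto
  have "rec_nat (bounded_eval f s zs)
      (\<lambda>k v. if v = 0 then 0 else bounded_eval g s (k # (v - 1) # zs)) m = Suc z
    \<Longrightarrow> rec_eval (PrimRec f g) (m # zs) z" for m z
  proof (induction m arbitrary: z)
    case 0
    then show ?case by (auto intro: rec_eval.prim_0 PrimRec.IH(1))
  next
    case (Suc m)
    let ?v = "rec_nat (bounded_eval f s zs)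
      (\<lambda>k v. if v = 0 then 0 else bounded_eval g s (k # (v - 1) # zs)) m"
    from Suc.prems obtain w where w: "?v = Suc w" by (cases ?v) auto
    then show ?case using Suc by (auto intro: rec_eval.prim_Suc PrimRec.IH(2))
  qed
  then show ?case using PrimRec.prems by (simp add: xs cong: if_cong)
next
  case (Mu f)
  from Mu.prems have found: "bounded_eval f s (y # xs) = Suc 0"
    and before: "\<And>i. i < y \<Longrightarrow> bounded_eval f s (i # xs) > 1"
    by (simp_all add: bounded_eval_Mu_iff del: bounded_eval.simps)
  show ?case
  proof (rule rec_eval.mu)
    show "rec_eval f (y # xs) 0" using found by (rule Mu.IH)
    show "\<forall>i<y. \<exists>z>0. rec_eval f (i # xs) z"
    proof (intro allI impI)
      fix i
      assume "i < y"
      from before[OF this] obtain z where "bounded_eval f s (i # xs) = Suc (Suc z)"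
        by (auto simp: less_iff_Suc_add)
      then show "\<exists>z>0. rec_eval f (i # xs) z" using Mu.IH by blast
    qed
  qed
qed

text \<open>Claiming this for all large \<open>s\<close>, not just for some \<open>s\<close>, lets
  the finitely many subcomputations share one bound without any appeal to monotonicity in
  \<open>s\<close>.\<close>

lemma bounded_eval_eventually: "rec_eval p xs y \<Longrightarrow> \<forall>\<^sub>F s in sequentially. bounded_eval p s xs = Suc y"
proof (induction rule: rec_eval.induct)
  case (comp xs gs ys f z)
  have "\<forall>\<^sub>F s in sequentially. \<forall>i\<in>{..<length gs}. bounded_eval (gs ! i) s xs = Suc (ys ! i)"
    using comp.IH(1) by (intro eventually_ball_finite) (auto simp: list_all2_conv_all_nth)
  with comp.IH(2) show ?case
  proof eventually_elim
    case (elim s)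
    then have "map (\<lambda>g. bounded_eval g s xs - 1) gs = ys"
      using comp.IH(1) by (auto simp: list_all2_conv_all_nth intro!: nth_equalityI)
    moreover have "0 \<notin> set (map (\<lambda>g. bounded_eval g s xs) gs)"
      using elim(2) by (force simp: in_set_conv_nth)
    ultimately show ?case using elim(1) by simp
  qed
next
  case (prim_Suc f g n xs y z)
  from prim_Suc.IH show ?case by eventually_elim (simp cong: if_cong)
next
  case (mu f n xs)
  have "\<forall>\<^sub>F s in sequentially. bounded_eval f s (i # xs) > 1" if "i < n" for i
  proof -
    obtain y where "y > 0" "\<forall>\<^sub>F s in sequentially. bounded_eval f s (i # xs) = Suc y"
      using mu.IH(2)[rule_format, OF \<open>i < n\<close>] by metis
    then show ?thesis by (auto elim: eventually_mono)
  qed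
  then have "\<forall>\<^sub>F s in sequentially. \<forall>i\<in>{..<n}. bounded_eval f s (i # xs) > 1"
    by (intro eventually_ball_finite) auto
  \<comment> \<open>The search has to run past \<open>n\<close>, hence the extra condition
    \<open>n < s\<close>.\<close>
  with mu.IH(1) eventually_gt_at_top[of n] show ?case
    by eventually_elim (simp add: bounded_eval_Mu_iff del: bounded_eval.simps)
qed auto

section \<open>Recursiveness of bounded evaluation\<close>

lemma recfn_guard:
  assumes "recfn n H" "\<And>G. G \<in> set Gs \<Longrightarrow> recfn n G"
  shows "recfn n (\<lambda>xs. if \<exists>G\<in>set Gs. G xs = 0 then 0 else H xs)"
  using assms(2)
proof (induction Gs)
  case Nil
  then show ?case using assms(1) by simp
next
  case (Cons G Gs)
  have "recfn n (\<lambda>xs. if G xs = 0 then 0 else if \<exists>G\<in>set Gs. G xs = 0 then 0 else H xs)"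
    using Cons by (intro recfn_if recfn_zero) auto
  then show ?case by (rule recfn_cong) auto
qed

lemma recfn_search_step:
  "recfn n K \<Longrightarrow> recfn n V \<Longrightarrow> recfn n E \<Longrightarrow> recfn n (\<lambda>xs. search_step (K xs) (V xs) (E xs))"
  unfolding search_step_def by (intro recfn_if recfn_pred recfn_Suc recfn_const recfn_zero)

text \<open>Every loop of \<open>bounded_eval\<close> is a \<open>rec_nat\<close>, so each clause is
  a composition, recursion or case distinction. \<open>n\<close> varies in the induction because
  subprograms are called with other numbers of arguments.\<close>

lemma recfn_bounded_eval: "recfn (Suc n) (\<lambda>ys. bounded_eval p (hd ys) (tl ys))"
proof (induction p arbitrary: n)
  case Zero
  then show ?case by (simp add: recfn_const[of _ "Suc 0"])
next
  case Succ
  show ?case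
  proof (cases n)
    case 0
    show ?thesis by (rule recfn_cong[OF recfn_zero]) (auto simp: 0 length_Suc_conv)
  next
    case (Suc m)
    have "recfn (Suc n) (\<lambda>ys. Suc (Suc (ys ! 1)))"
      by (intro recfn_Suc recfn_proj) (simp add: Suc)
    then show ?thesis by (rule recfn_cong) (auto simp: Suc length_Suc_conv)
  qed
next
  case (Proj i)
  show ?case
  proof (cases "i < n")
    case True
    then have "recfn (Suc n) (\<lambda>ys. Suc (ys ! Suc i))"
      by (intro recfn_Suc recfn_proj) simp
    then show ?thesis by (rule recfn_cong) (auto simp: True nth_tl)
  next
    case False
    show ?thesis by (rule recfn_cong[OF recfn_zero]) (simp add: False)
  qed
next
  case (Comp f gs)
  let ?G = "\<lambda>g ys. bounded_eval g (hd ys) (tl ys)"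
  \<comment> \<open>The leading projection passes the bound on to \<open>f\<close>.\<close>
  let ?Gs = "(\<lambda>ys. ys ! 0) # map (\<lambda>g ys. ?G g ys - 1) gs"
  have "recfn (length ?Gs) (\<lambda>ys. bounded_eval f (hd ys) (tl ys))"
    using Comp.IH(1) by simp
  then have "recfn (Suc n) (\<lambda>ys. ?G f (map (\<lambda>G. G ys) ?Gs))"
    by (rule recfn_compose) (auto intro!: recfn_proj recfn_pred[unfolded One_nat_def] Comp.IH(2))
  then have "recfn (Suc n) (\<lambda>ys. if \<exists>G\<in>set (map ?G gs). G ys = 0 then 0
      else ?G f (map (\<lambda>G. G ys) ?Gs))"
    by (rule recfn_guard) (use Comp.IH(2) in auto)
  then show ?case
    by (rule recfn_cong) (auto simp: o_def length_Suc_conv)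
next
  case (PrimRec f g)
  show ?case
  proof (cases n)
    case 0
    show ?thesis by (rule recfn_cong[OF recfn_zero]) (auto simp: 0 length_Suc_conv)
  next
    case (Suc m)
    let ?F = "\<lambda>ys. bounded_eval f (hd ys) (tl ys)"
    let ?G = "\<lambda>ys. bounded_eval g (hd ys) (tl ys)"
    let ?A = "\<lambda>ys. ?F (map (\<lambda>G. G ys) [\<lambda>ys. ys ! 0] @ drop 2 ys)"
    \<comment> \<open>With \<open>ys = s # x # ps\<close>, the list is
      \<open>zs = k # v # ys\<close> for the counter \<open>k\<close> and the previous result
      \<open>v\<close>; \<open>g\<close> is run on \<open>k # (v - 1) # ps\<close> with bound
      \<open>s\<close>.\<close>
    let ?B = "\<lambda>zs. if zs ! 1 = 0 then 0
      else ?G (map (\<lambda>G. G zs) [\<lambda>zs. zs ! 2, \<lambda>zs. zs ! 0, \<lambda>zs. zs ! 1 - 1] @ drop 4 zs)"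
    have A: "recfn (Suc n) ?A"
      by (rule recfn_compose_append[where m = m])
        (use PrimRec.IH(1)[of m] Suc in \<open>auto intro: recfn_proj\<close>)
    have B: "recfn (Suc (Suc (Suc n))) ?B"
      by (intro recfn_if recfn_proj recfn_zero recfn_compose_append[where m = m])
        (use PrimRec.IH(2)[of "Suc (Suc m)"] Suc in \<open>auto intro!: recfn_pred[unfolded One_nat_def] recfn_proj\<close>)
    have "recfn (Suc n) (\<lambda>ys. ys ! 1)"
      by (rule recfn_proj) (simp add: Suc)
    from recfn_rec_nat[OF this A B] show ?thesis
      by (rule recfn_cong) (auto simp: Suc length_Suc_conv numeral_eq_Suc cong: if_cong)
  qed
next
  case (Mu f)
  let ?F = "\<lambda>ys. bounded_eval f (hd ys) (tl ys)"
  \<comment> \<open>Here \<open>zs = k # v # s # xs\<close>. The loop below runs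
    \<open>ys ! 0\<close> times, which is the bound \<open>s\<close> itself.\<close>
  let ?B = "\<lambda>zs. search_step (zs ! 0) (zs ! 1)
    (?F (map (\<lambda>G. G zs) [\<lambda>zs. zs ! 2, \<lambda>zs. zs ! 0] @ drop 3 zs))"
  have B: "recfn (Suc (Suc (Suc n))) ?B"
    by (intro recfn_search_step recfn_proj recfn_compose_append[where m = n])
      (use Mu.IH[of "Suc n"] in \<open>auto intro!: recfn_proj\<close>)
  have "recfn (Suc n) (\<lambda>ys. ys ! 0)"
    by (rule recfn_proj) simp
  from recfn_pred[OF recfn_rec_nat[OF this recfn_zero B]] show ?case
    by (rule recfn_cong) (auto simp: length_Suc_conv numeral_eq_Suc)
qed

lemma ce_rel_uniformization:
  assumes R: "ce_rel R" and total: "\<And>x. \<exists>y. (x, y) \<in> R"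
  obtains h where "computable h" "\<And>x. (x, h x) \<in> R"
proof -
  obtain p where p: "\<And>x y. (x, y) \<in> R \<longleftrightarrow> (\<exists>z. rec_eval p [x, y] z)"
    using R unfolding ce_rel_def by blast
  \<comment> \<open>0 if nothing is found, otherwise \<open>Suc k\<close> for the largest
    \<open>k < t\<close> accepted with bound \<open>s\<close>.\<close>
  define last_hit where "last_hit s x t =
    rec_nat 0 (\<lambda>k v. if bounded_eval p s [x, k] = 0 then v else Suc k) t" for s x t
  have last_hit_eq_0: "last_hit s x t = 0 \<longleftrightarrow> (\<forall>k<t. bounded_eval p s [x, k] = 0)" for s x t
    unfolding last_hit_def by (induction t) (auto simp: less_Suc_eq)
  have last_hit_sound: "last_hit s x t = Suc y \<Longrightarrow> bounded_eval p s [x, y] \<noteq> 0" for s x t y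
    unfolding last_hit_def by (induction t) (auto split: if_splits)
  let ?E = "\<lambda>ys. bounded_eval p (hd ys) (tl ys)"
  \<comment> \<open>The list \<open>zs\<close> is \<open>[k, v, s, x]\<close>.\<close>
  let ?B = "\<lambda>zs. if ?E (map (\<lambda>G. G zs) [\<lambda>zs. zs ! 2, \<lambda>zs. zs ! 3, \<lambda>zs. zs ! 0]) = 0
    then zs ! 1 else Suc (zs ! 0)"
  have "recfn (Suc (Suc 2)) ?B"
    by (intro recfn_if recfn_compose recfn_Suc recfn_proj)
      (use recfn_bounded_eval[of 2 p] in \<open>auto simp: numeral_3_eq_3 numeral_2_eq_2 intro!: recfn_proj\<close>)
  then have "recfn 2 (\<lambda>xs. rec_nat 0 (\<lambda>k v. ?B (k # v # xs)) (xs ! 0))"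
    by (intro recfn_rec_nat recfn_zero recfn_proj) simp_all
  then have V: "recfn 2 (\<lambda>xs. last_hit (xs ! 0) (xs ! 1) (xs ! 0))"
    by (rule recfn_cong) (auto simp: last_hit_def numeral_eq_Suc length_Suc_conv cong: if_cong)
  \<comment> \<open>Reverses the truth value, since \<open>recfn_Least\<close> looks for a
    zero.\<close>
  define fails where "fails s x = (if last_hit s x s = 0 then 1 else 0 :: nat)" for s x
  have fails: "recfn 2 (\<lambda>xs. fails (xs ! 0) (xs ! 1))"
    unfolding fails_def by (intro recfn_if V recfn_const recfn_zero)
  define stage where "stage x = (LEAST s. fails s x = 0)" for x
  have ex: "\<exists>s. fails s x = 0" for x
  proof -
    obtain y z where "rec_eval p [x, y] z"
      using total p by blast
    then have "\<forall>\<^sub>F s in sequentially. y < s \<and> bounded_eval p s [x, y] = Suc z"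
      by (intro eventually_conj eventually_gt_at_top bounded_eval_eventually)
    then obtain s where "y < s" "bounded_eval p s [x, y] = Suc z"
      by (auto simp: eventually_sequentially)
    then have "last_hit s x s \<noteq> 0" unfolding last_hit_eq_0 by auto
    then show ?thesis by (auto simp: fails_def)
  qed
  have "recfn 1 (\<lambda>xs. LEAST s. fails ((s # xs) ! 0) ((s # xs) ! 1) = 0)"
    by (rule recfn_Least) (use fails ex in \<open>simp_all add: numeral_2_eq_2\<close>)
  then have "recfn 1 (\<lambda>xs. stage (xs ! 0))"
    by (rule recfn_cong) (simp add: stage_def)
  then have "recfn 1 (\<lambda>xs. last_hit ([stage (xs ! 0), xs ! 0] ! 0) ([stage (xs ! 0), xs ! 0] ! 1)
      ([stage (xs ! 0), xs ! 0] ! 0) - 1)"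
    by (intro recfn_pred recfn_compose2[OF V] recfn_proj) simp_all
  then have "recfn 1 (\<lambda>xs. last_hit (stage (hd xs)) (hd xs) (stage (hd xs)) - 1)"
    by (rule recfn_cong) (auto simp: length_Suc_conv)
  then have "computable (\<lambda>x. last_hit (stage x) x (stage x) - 1)"
    by (simp add: computable_iff_recfn)
  moreover have "(x, last_hit (stage x) x (stage x) - 1) \<in> R" for x
  proof -
    have "fails (stage x) x = 0"
      unfolding stage_def by (rule LeastI_ex[OF ex])
    then obtain y where y: "last_hit (stage x) x (stage x) = Suc y"
      by (cases "last_hit (stage x) x (stage x)") (auto simp: fails_def)
    then obtain z where "bounded_eval p (stage x) [x, y] = Suc z"
      using last_hit_sound not0_implies_Suc by blast
    then have "\<exists>z. rec_eval p [x, y] z" using bounded_eval_sound by blast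
    then show ?thesis using y p by simp
  qed
  ultimately show ?thesis by (rule that)
qed

section \<open>Ceers\<close>

lemma rec_eval_Proj_iff: "rec_eval (Proj i) xs y \<longleftrightarrow> i < length xs \<and> y = xs ! i"
  by (subst rec_eval.simps) auto

text \<open>Both functions are total, so the composed program halts exactly when the one for
  \<open>R\<close> does. Keeping \<open>f\<close> and \<open>g\<close> separate allows the identity
  on one side.\<close>

lemma ce_rel_vimage:
  assumes "ce_rel R" "computable f" "computable g"
  shows "ce_rel {(x, y). (f x, g y) \<in> R}"
proof -
  obtain p q r where "\<And>x y. (x, y) \<in> R \<longleftrightarrow> (\<exists>z. rec_eval p [x, y] z)"
    "\<And>x y. rec_eval q [x] y \<longleftrightarrow> y = f x" "\<And>x y. rec_eval r [x] y \<longleftrightarrow> y = g x"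
    using assms unfolding ce_rel_def computable_def by blast
  moreover have "rec_eval (Proj 0) [x, y] z \<longleftrightarrow> z = x" "rec_eval (Proj 1) [x, y] z \<longleftrightarrow> z = y"
    for x y z by (simp_all add: rec_eval_Proj_iff)
  ultimately have "(f x, g y) \<in> R \<longleftrightarrow>
      (\<exists>z. rec_eval (Comp p [Comp q [Proj 0], Comp r [Proj 1]]) [x, y] z)" for x y
    by (auto simp: rec_eval_Comp_iff list_all2_Cons1)
  then show ?thesis unfolding ce_rel_def by blast
qed

lemma ceer_vimage:
  assumes "ceer R" "computable f"
  shows "ceer {(x, y). (f x, f y) \<in> R}"
proof -
  have "equiv UNIV R" using assms(1) by (simp add: ceer_def)
  then have "equiv UNIV {(x, y). (f x, f y) \<in> R}"
    by (auto simp: equiv_def refl_on_def intro!: symI transI elim: symE transE)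
  then show ?thesis using assms ce_rel_vimage by (auto simp: ceer_def)
qed

section \<open>Iteration and case distinction for computable functions\<close>

lemma computable_rec_nat:
  assumes "computable f"
  shows "computable (rec_nat a (\<lambda>_. f))"
proof -
  have "recfn 3 (\<lambda>ys. f (hd [ys ! 1]))"
    using recfn_compose1[of "\<lambda>xs. f (hd xs)" 3 "\<lambda>ys. ys ! 1"] assms
    by (simp add: computable_iff_recfn recfn_proj)
  then have "recfn 1 (\<lambda>xs. rec_nat a (\<lambda>k v. f (hd [(k # v # xs) ! 1])) (xs ! 0))"
    by (intro recfn_rec_nat recfn_const recfn_proj) (simp_all add: numeral_3_eq_3)
  then have "recfn 1 (\<lambda>xs. rec_nat a (\<lambda>_. f) (hd xs))"
    by (rule recfn_cong) (auto simp: length_Suc_conv)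
  then show ?thesis by (simp add: computable_iff_recfn)
qed

lemma computable_case_nat:
  assumes "computable f"
  shows "computable (case_nat a f)"
proof -
  have "recfn 3 (\<lambda>ys. f (hd [ys ! 0]))"
    using recfn_compose1[of "\<lambda>xs. f (hd xs)" 3 "\<lambda>ys. ys ! 0"] assms
    by (simp add: computable_iff_recfn recfn_proj)
  then have "recfn 1 (\<lambda>xs. rec_nat a (\<lambda>k v. f (hd [(k # v # xs) ! 0])) (xs ! 0))"
    by (intro recfn_rec_nat recfn_const recfn_proj) (simp_all add: numeral_3_eq_3)
  then have "recfn 1 (\<lambda>xs. case_nat a f (hd xs))"
    by (rule recfn_cong) (auto simp: length_Suc_conv split: nat.split)
  then show ?thesis by (simp add: computable_iff_recfn)
qed

lemma computable_Suc: "computable Suc"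
  unfolding computable_iff_recfn
  by (intro recfn_Suc recfn_cong[OF recfn_proj[of 0 1]]) (auto simp: length_Suc_conv)

text \<open>The shift by \<open>Suc\<close> frees 0 for the new class; maps out of the sum are then
  \<open>case_nat a f\<close>, with no even-odd coding.\<close>

definition add_class :: "nat rel \<Rightarrow> nat rel" where
  "add_class D = insert (0, 0) {(Suc x, Suc y) | x y. (x, y) \<in> D}"

lemma add_class_simps [simp]:
  "(0, 0) \<in> add_class D" "(0, Suc y) \<notin> add_class D" "(Suc x, 0) \<notin> add_class D"
  "(Suc x, Suc y) \<in> add_class D \<longleftrightarrow> (x, y) \<in> D"
  by (auto simp: add_class_def)

text \<open>\<open>f\<close> misses the class of \<open>a\<close>, so 0 can be sent there. The
  equality later serves twice: as a reduction and, by \<open>ceer_vimage\<close>, to show that the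
  left side is a ceer.\<close>

lemma add_class_vimage:
  assumes "equiv UNIV E" "\<And>x y. (x, y) \<in> D \<longleftrightarrow> (f x, f y) \<in> E" "\<And>y. (a, f y) \<notin> E"
  shows "add_class D = {(x, y). (case_nat a f x, case_nat a f y) \<in> E}"
proof -
  have "(f y, a) \<notin> E" for y
    using assms(1,3) by (meson equivE symE)
  moreover have "(a, a) \<in> E"
    using assms(1) by (meson equivE refl_onD UNIV_I)
  ultimately have "(x, y) \<in> add_class D \<longleftrightarrow> (case_nat a f x, case_nat a f y) \<in> E" for x y
    using assms(2,3) by (cases x; cases y) simp_all
  then show ?thesis by auto
qed

lemma add_class_reducible:
  assumes E: "ceer E" and "D \<le>\<^sub>c E" and "\<not> E \<le>\<^sub>c D"
  shows "add_class D \<le>\<^sub>c E" and "ceer (add_class D)"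
proof -
  obtain f where f: "computable f" "\<And>x y. (x, y) \<in> D \<longleftrightarrow> (f x, f y) \<in> E"
    using assms(2) unfolding reducible_def by blast
  have eqv: "equiv UNIV E" and "ce_rel E" using E by (auto simp: ceer_def)
  have "\<exists>a. \<forall>y. (a, f y) \<notin> E"
  proof (rule ccontr)
    assume onto: "\<nexists>a. \<forall>y. (a, f y) \<notin> E"
    have "ce_rel {(x, y). (x, f y) \<in> E}"
      using ce_rel_vimage[OF \<open>ce_rel E\<close> computable_id f(1)] .
    then obtain h where h: "computable h" "\<And>x. (x, f (h x)) \<in> E"
      using onto by (elim ce_rel_uniformization) auto
    \<comment> \<open>Whichever preimage \<open>h\<close> picks, \<open>x\<close> is equivalent to
      \<open>f (h x)\<close>, and \<open>f\<close> reflects equivalence back to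
      \<open>D\<close>.\<close>
    then have "(x, y) \<in> E \<longleftrightarrow> (h x, h y) \<in> D" for x y
      unfolding f(2) using eqv by (meson equivE symE transE)
    then have "E \<le>\<^sub>c D" unfolding reducible_def using h(1) by blast
    then show False using assms(3) by simp
  qed
  then obtain a where a: "\<And>y. (a, f y) \<notin> E" by blast
  note eq = add_class_vimage[OF eqv f(2) a]
  note comp = computable_case_nat[OF f(1), of a]
  show "add_class D \<le>\<^sub>c E"
    unfolding reducible_def using comp by (intro exI[of _ "case_nat a f"]) (simp add: eq)
  show "ceer (add_class D)"
    using ceer_vimage[OF E comp] by (simp add: eq)
qed

lemma Id_reducible_if_add_class_reducible:
  assumes "ceer D" "add_class D \<le>\<^sub>c D"
  shows "Id \<le>\<^sub>c D"
proof -
  obtain h where h: "computable h" "\<And>x y. (x, y) \<in> add_class D \<longleftrightarrow> (h x, h y) \<in> D"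
    using assms(2) unfolding reducible_def by blast
  have eqv: "equiv UNIV D" using assms(1) by (simp add: ceer_def)
  define u where "u = rec_nat (h 0) (\<lambda>_ x. h (Suc x))"
  have "computable u"
    unfolding u_def by (rule computable_rec_nat[OF computable_compose[OF computable_Suc h(1)]])
  have u_Suc: "u (Suc i) = h (Suc (u i))" and u_0: "u 0 = h 0" for i
    by (simp_all add: u_def)
  \<comment> \<open>\<open>h 0\<close> is inequivalent to every \<open>h (Suc x)\<close>, and
    \<open>h (Suc x)\<close>, \<open>h (Suc y)\<close> are equivalent only if \<open>x\<close> and
    \<open>y\<close> are. So one step is stripped from both sides until one of them is
    \<open>h 0\<close>.\<close>
  have "(u i, u j) \<in> D \<longleftrightarrow> i = j" for i j
  proof (induction i arbitrary: j)
    case 0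
    show ?case by (cases j) (simp_all add: u_0 u_Suc flip: h(2))
  next
    case (Suc i)
    then show ?case by (cases j) (simp_all add: u_0 u_Suc flip: h(2))
  qed
  then show ?thesis
    unfolding reducible_def using \<open>computable u\<close> by (intro exI[of _ u]) simp
qed

section \<open>Absence of a greatest lower bound\<close>

theorem theorem7p19:
  fixes E1 E2 :: "nat rel"
  assumes "ceer E1" and "ceer E2"
    and "\<not> E1 \<le>\<^sub>c E2" and "\<not> E2 \<le>\<^sub>c E1"
    and "dark E1 \<or> dark E2"
  shows "\<not> (\<exists>d. is_glb ceer_degrees d {ceer_degree E1, ceer_degree E2})"
proof
  assume "\<exists>d. is_glb ceer_degrees d {ceer_degree E1, ceer_degree E2}"
  then obtain d where d: "is_glb ceer_degrees d {ceer_degree E1, ceer_degree E2}" by blast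
  then have "d \<in> carrier ceer_degrees" by (auto simp: greatest_def Lower_def)
  then obtain D where D: "ceer D" and d_eq: "d = ceer_degree D"
    by (auto simp: carrier_ceer_degrees)
  have mem: "ceer_degree E \<in> carrier ceer_degrees" if "ceer E" for E
    using that by (simp add: carrier_ceer_degrees)
  have le: "D \<le>\<^sub>c E1" "D \<le>\<^sub>c E2"
    using d assms(1,2) D mem
    by (auto simp: greatest_def Lower_def d_eq ceer_degree_le_iff)
  \<comment> \<open>The property of the degree \<open>d\<close> is restated for ceers as
    representatives.\<close>
  have greatest: "B \<le>\<^sub>c D" if "ceer B" "B \<le>\<^sub>c E1" "B \<le>\<^sub>c E2" for B
  proof -
    have "ceer_degree B \<in> Lower ceer_degrees {ceer_degree E1, ceer_degree E2}"
      using that assms(1,2) mem by (auto simp: Lower_def ceer_degree_le_iff)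
    with d have "ceer_degree B \<sqsubseteq>\<^bsub>ceer_degrees\<^esub> d"
      unfolding greatest_def by blast
    then show ?thesis
      using that(1) D by (simp add: d_eq ceer_degree_le_iff)
  qed
  \<comment> \<open>Otherwise \<open>E1\<close> would lie below \<open>E2\<close> through
    \<open>D\<close>, or \<open>E2\<close> below \<open>E1\<close>.\<close>
  have not_le: "\<not> E1 \<le>\<^sub>c D" "\<not> E2 \<le>\<^sub>c D"
    using le assms(3,4) reducible_trans[of E1 D E2] reducible_trans[of E2 D E1] by blast+
  note E1 = add_class_reducible[OF assms(1) le(1) not_le(1)]
  note E2 = add_class_reducible[OF assms(2) le(2) not_le(2)]
  have "add_class D \<le>\<^sub>c D"
    by (rule greatest[OF E1(2,1) E2(1)])
  then have "Id \<le>\<^sub>c D"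
    by (rule Id_reducible_if_add_class_reducible[OF D])
  \<comment> \<open>\<open>Id\<close> lies below both \<open>E1\<close> and \<open>E2\<close>
    through \<open>D\<close>, which refutes either case of the darkness assumption.\<close>
  then show False
    using le assms(5) reducible_trans[of Id D] unfolding dark_def by blast
qed

end
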